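(* Septisection of arbitrary angles is possible with 2-fold origami. That is: for every $\varphi\in(0,2\pi)$, the real numbers $\cos(\varphi/7)$ and $\sin(\varphi/7)$ are constructible by 2-fold origami from the data $\{\cos\varphi,\sin\varphi\}$.
   Context: For a line $l\subset\mathbb{R}^2$, write $P^l$ and $L^l$ for the image of a point $P$, resp. a line $L$, under reflection across $l$ (the "folded point" and "folded line"). 2-fold origami. Given a set $E\subset\mathbb{R}$ of data, one starts with the points $(0,0),(1,0),(0,1)$ and $(s,0)$ for $s\in E$, and successively constructs points and lines by the following operations. (i) The intersection point of two distinct non-parallel constructed lines is constructed; the images $P^l$, $L^l$ of constructed points $P$ and lines $L$ under reflection across a constructed line $l$ are constructed. (ii) (1-fold step) A line $l$ is constructed if it satisfies a finite set of alignments that is satisfied by only finitely many lines, where an alignment is a condition that two points coincide, a point lies on a line, or two lines coincide, among the objects: constructed points $P$, constructed lines $L$, the fold line $l$, and the folded objects $P^l$, $L^l$. (iii) (2-fold step) Two lines $l_a,l_b$ are simultaneously constructed if the pair $(l_a,l_b)$ satisfies a finite set of alignments that is satisfied by only finitely many pairs of lines, where alignments are now conditions of the same three types among the objects: constructed points $P$, constructed lines $L$, the fold lines $l_a,l_b$, and the folded objects $P^{l_a},P^{l_b},L^{l_a},L^{l_b},l_a^{l_b},l_b^{l_a}$. An example of a 2-fold step is the axiom AL6ab8: given constructed points $P,Q,R,S$ and lines $m,n$, construct $l_1,l_2$ with $P^{l_1}\in m$, $R^{l_2}\in n$ and $Q^{l_1}=S^{l_2}$ (whenever there are only finitely many such pairs).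 A real number $r$ is constructible by 2-fold origami from $E$ if the point $(r,0)$ can be constructed in finitely many such steps from $E$. *)

theory Defs
  imports "HOL-Analysis.Analysis"
begin

type_synonym point = "real \<times> real"
type_synonym line = "point set"

definition is_line :: "line \<Rightarrow> bool" where
  "is_line l \<longleftrightarrow> affine l \<and> aff_dim l = 1"

(* On a line l, closest_point l P is the foot of the perpendicular from P to l. *)
definition reflect :: "line \<Rightarrow> point \<Rightarrow> point" where
  "reflect l P = 2 *\<^sub>R closest_point l P - P"

(* Objects and alignments are represented as functions of the unknown fold f: a single line
   in a 1-fold step and a pair of lines in a 2-fold step. *)
definition alignments ::
    "('f \<Rightarrow> point) set \<Rightarrow> ('f \<Rightarrow> line) set \<Rightarrow> ('f \<Rightarrow> bool) set" where
  "alignments X Y =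
     {(\<lambda>f. p f = q f) | p q. p \<in> X \<and> q \<in> X} \<union>
     {(\<lambda>f. p f \<in> m f) | p m. p \<in> X \<and> m \<in> Y} \<union>
     {(\<lambda>f. m f = n f) | m n. m \<in> Y \<and> n \<in> Y}"

definition one_fold_points :: "point set \<Rightarrow> (line \<Rightarrow> point) set" where
  "one_fold_points Ps = {(\<lambda>l. P) | P. P \<in> Ps} \<union> {(\<lambda>l. reflect l P) | P. P \<in> Ps}"

definition one_fold_lines :: "line set \<Rightarrow> (line \<Rightarrow> line) set" where
  "one_fold_lines Ls =
     {(\<lambda>l. L) | L. L \<in> Ls} \<union> {\<lambda>l. l} \<union> {(\<lambda>l. reflect l ` L) | L. L \<in> Ls}"

definition two_fold_points :: "point set \<Rightarrow> (line \<times> line \<Rightarrow> point) set" where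
  "two_fold_points Ps =
     {(\<lambda>(a, b). P) | P. P \<in> Ps} \<union>
     {(\<lambda>(a, b). reflect a P) | P. P \<in> Ps} \<union>
     {(\<lambda>(a, b). reflect b P) | P. P \<in> Ps}"

definition two_fold_lines :: "line set \<Rightarrow> (line \<times> line \<Rightarrow> line) set" where
  "two_fold_lines Ls =
     {(\<lambda>(a, b). L) | L. L \<in> Ls} \<union>
     {\<lambda>(a, b). a, \<lambda>(a, b). b} \<union>
     {(\<lambda>(a, b). reflect a ` L) | L. L \<in> Ls} \<union>
     {(\<lambda>(a, b). reflect b ` L) | L. L \<in> Ls} \<union>
     {\<lambda>(a, b). reflect b ` a, \<lambda>(a, b). reflect a ` b}"

definition one_fold_solutions :: "(line \<Rightarrow> bool) set \<Rightarrow> line set" where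
  "one_fold_solutions A = {l. is_line l \<and> (\<forall>c\<in>A. c l)}"

definition two_fold_solutions :: "(line \<times> line \<Rightarrow> bool) set \<Rightarrow> (line \<times> line) set" where
  "two_fold_solutions A = {(a, b). is_line a \<and> is_line b \<and> (\<forall>c\<in>A. c (a, b))}"

(* origami_stage E Ps Ls: after finitely many steps from the data E, Ps and Ls are the sets of
   points and lines constructed so far.  In the rule intersection, two lines are distinct and
   non-parallel exactly if they meet in a single point. *)
inductive origami_stage :: "real set \<Rightarrow> point set \<Rightarrow> line set \<Rightarrow> bool" for E :: "real set" where
  start: "origami_stage E ({(0, 0), (1, 0), (0, 1)} \<union> {(s, 0) | s. s \<in> E}) {}"
| intersection: "origami_stage E (insert P Ps) Ls"
    if "origami_stage E Ps Ls" "L \<in> Ls" "M \<in> Ls" "L \<inter> M = {P}"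
| reflect_point: "origami_stage E (insert (reflect l P) Ps) Ls"
    if "origami_stage E Ps Ls" "l \<in> Ls" "P \<in> Ps"
| reflect_line: "origami_stage E Ps (insert (reflect l ` L) Ls)"
    if "origami_stage E Ps Ls" "l \<in> Ls" "L \<in> Ls"
| one_fold: "origami_stage E Ps (insert l Ls)"
    if "origami_stage E Ps Ls"
      "finite A" "A \<subseteq> alignments (one_fold_points Ps) (one_fold_lines Ls)"
      "finite (one_fold_solutions A)" "l \<in> one_fold_solutions A"
| two_fold: "origami_stage E Ps (insert a (insert b Ls))"
    if "origami_stage E Ps Ls"
      "finite A" "A \<subseteq> alignments (two_fold_points Ps) (two_fold_lines Ls)"
      "finite (two_fold_solutions A)" "(a, b) \<in> two_fold_solutions A"

definition two_fold_constructible :: "real set \<Rightarrow> real \<Rightarrow> bool" where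
  "two_fold_constructible E r \<longleftrightarrow> (\<exists>Ps Ls. origami_stage E Ps Ls \<and> (r, 0) \<in> Ps)"

end

theory Submission
  imports Defs
begin

text \<open>
  The plane is read as the complex numbers, and a line is given by a unit normal \<open>u\<close> and an offset
  \<open>p\<close>: it consists of the \<open>z\<close> with \<open>Re (cnj u * z) = p\<close>.  Reflection across it is
  \<open>z \<mapsto> 2 * p * u - u\<^sup>2 * cnj z\<close>, so alignments become polynomial equations in the unit normals
  of the folds.

  One double fold does the septisection.  Let \<open>Y\<close> be the imaginary axis and \<open>n\<close> a line through the
  point \<open>1\<close> with unit normal \<open>m\<close>.  The folds \<open>a\<close> (normal \<open>u\<close>, offset \<open>p\<close>) and \<open>b\<close> (normal \<open>w\<close>,
  offset \<open>q\<close>) are required to satisfy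

  \<^item> \<open>a\<close> folded along \<open>b\<close> is \<open>Y\<close> folded along \<open>a\<close>,
  \<^item> the image of \<open>1\<close> under \<open>a\<close> lies on \<open>Y\<close>,
  \<^item> the image of \<open>-1\<close> under \<open>b\<close> lies on \<open>n\<close>.

  By the first condition \<open>b\<close> bisects the angle between \<open>a\<close> and the image of \<open>Y\<close>.  If \<open>u\<close> has
  argument \<open>\<delta>\<close>, the image of \<open>Y\<close> has a normal of argument \<open>2 * \<delta>\<close>, so \<open>b\<close> has one of argument
  \<open>3 * \<delta> / 2\<close> up to right angles: \<open>w\<^sup>2 = \<sigma> * u ^ 3\<close> with \<open>\<sigma> = \<plusminus>1\<close>.  The offsets are then determined by
  the first two conditions, and the third turns into an equation for \<open>u\<close> alone.  A priori it has
  degree nine, but the positions of \<open>1\<close>, \<open>-1\<close> and \<open>n\<close> are chosen such that it factors as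
  \<open>(u\<^sup>2 + \<sigma> * u + 1) * (u ^ 7 + \<sigma> * m\<^sup>2) = 0\<close> (lemma \<open>septic_equation\<close>).  This shows at once that only
  finitely many pairs of folds exist (\<open>finite_septisection_folds\<close>) and that, for
  \<open>m = \<i> * cis (\<phi> / 2)\<close> and \<open>\<sigma> = 1\<close>, the normal \<open>u = cis (\<phi> / 7)\<close> belongs to one of them
  (\<open>septisection_folds_exist\<close>).

  Since 7 is odd, \<open>u\<close> itself is obtained from the point \<open>u ^ 7 = cis \<phi>\<close> by reflections alone:
  reflecting in the line through the origin with direction \<open>u\<close> and then in the real axis multiplies
  by \<open>u\<close> to the power \<open>-2\<close>, and three rounds lead from \<open>u ^ 7\<close> to \<open>u\<close> (\<open>constructible_point_septisection\<close>).
\<close>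

section \<open>Lines and reflections in complex coordinates\<close>

definition pt :: "complex \<Rightarrow> point" where
  "pt z = (Re z, Im z)"

definition normal_line :: "complex \<Rightarrow> real \<Rightarrow> line" where
  "normal_line u p = {pt z | z. Re (cnj u * z) = p}"

lemma pt_eq_iff [simp]: "pt z = pt w \<longleftrightarrow> z = w"
  by (auto simp: pt_def complex_eq_iff)

lemma pt_minus: "pt (- z) = - pt z"
  by (simp add: pt_def)

lemma pt_eq_0_iff [simp]: "pt z = 0 \<longleftrightarrow> z = 0"
  by (simp add: pt_def zero_prod_def complex_eq_iff)

lemma pt_surj: "\<exists>z. P = pt z"
  by (rule exI[of _ "Complex (fst P) (snd P)"]) (simp add: pt_def)

lemma pt_in_normal_line [simp]: "pt z \<in> normal_line u p \<longleftrightarrow> Re (cnj u * z) = p"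
  by (auto simp: normal_line_def)

lemma normal_line_eq_hyperplane: "normal_line u p = {x. pt u \<bullet> x = p}"
proof (rule set_eqI)
  fix P
  obtain z where "P = pt z" using pt_surj by blast
  then show "P \<in> normal_line u p \<longleftrightarrow> P \<in> {x. pt u \<bullet> x = p}"
    by (simp only: pt_in_normal_line) (simp add: pt_def)
qed

lemma is_line_iff_normal_line: "is_line l \<longleftrightarrow> (\<exists>u p. cmod u = 1 \<and> l = normal_line u p)"
proof
  assume l: "is_line l"
  then have dim: "aff_dim l = int (DIM(point) - 1)" and hull: "affine hull l = l"
    by (auto simp: is_line_def)
  have "\<exists>A b. A \<noteq> 0 \<and> l = {x. A \<bullet> x = b}"
    using iffD1[OF aff_dim_eq_hyperplane dim] by (simp only: hull)
  then obtain A b where A: "A \<noteq> 0" "l = {x. A \<bullet> x = b}"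
    by blast
  obtain v where v: "A = pt v" using pt_surj by blast
  with A have "v \<noteq> 0" by auto
  define u where "u = v / cmod v"
  have "l = normal_line u (b / cmod v)"
  proof -
    have "pt u = (1 / cmod v) *\<^sub>R A" by (simp add: v u_def pt_def)
    then show ?thesis using A \<open>v \<noteq> 0\<close> by (simp add: normal_line_eq_hyperplane)
  qed
  moreover have "cmod u = 1" using \<open>v \<noteq> 0\<close> by (simp add: u_def norm_divide)
  ultimately show "\<exists>u p. cmod u = 1 \<and> l = normal_line u p" by blast
next
  assume "\<exists>u p. cmod u = 1 \<and> l = normal_line u p"
  then obtain u p where "cmod u = 1" "l = normal_line u p" by blast
  moreover from this have "pt u \<noteq> 0" by auto
  ultimately show "is_line l"
    by (simp add: is_line_def normal_line_eq_hyperplane affine_hyperplane aff_dim_hyperplane)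
qed

lemma unit_mult_cnj:
  assumes "cmod u = 1"
  shows "u * cnj u = 1" "cnj u * u = 1" "(Re u)\<^sup>2 + (Im u)\<^sup>2 = 1"
proof -
  show "u * cnj u = 1" using assms by (simp add: complex_norm_square[symmetric])
  then show "cnj u * u = 1" by (simp add: mult.commute)
  show "(Re u)\<^sup>2 + (Im u)\<^sup>2 = 1" using assms by (simp add: cmod_def)
qed

text \<open>By Cauchy--Schwarz, the foot is reached by moving along the unit normal.\<close>

lemma closest_point_normal_line:
  assumes u: "cmod u = 1"
  shows "closest_point (normal_line u p) (pt z) = pt (z + of_real (p - Re (cnj u * z)) * u)"
    (is "_ = pt ?y")
proof (rule closest_point_unique[symmetric])
  show "convex (normal_line u p)" "closed (normal_line u p)"
    by (simp_all add: normal_line_eq_hyperplane convex_hyperplane closed_hyperplane)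
  have "cnj u * ?y = cnj u * z + of_real (p - Re (cnj u * z)) * (cnj u * u)"
    by (simp add: algebra_simps)
  also have "\<dots> = cnj u * z + of_real (p - Re (cnj u * z))"
    by (simp only: unit_mult_cnj[OF u] mult_1_right)
  finally have "Re (cnj u * ?y) = p" by (simp only: plus_complex.simps Re_complex_of_real)
  then show "pt ?y \<in> normal_line u p" by (simp only: pt_in_normal_line)
  have dist_pt: "dist (pt a) (pt b) = cmod (a - b)" for a b
    by (simp add: pt_def dist_Pair_Pair dist_real_def cmod_def)
  show "\<forall>x\<in>normal_line u p. dist (pt z) (pt ?y) \<le> dist (pt z) x"
  proof
    fix x assume "x \<in> normal_line u p"
    then obtain t where t: "x = pt t" "p = Re (cnj u * t)" by (auto simp: normal_line_def)
    have "dist (pt z) (pt ?y) = \<bar>Re (cnj u * (t - z))\<bar>"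
    proof -
      have "z - ?y = - (of_real (Re (cnj u * (t - z))) * u)"
        unfolding t(2) by (simp only: ring_distribs minus_complex.simps) (simp add: algebra_simps)
      then show ?thesis unfolding dist_pt using u by (simp only: norm_minus_cancel norm_mult norm_of_real mult_1_right)
    qed
    also have "\<dots> \<le> cmod (cnj u * (t - z))" by (rule abs_Re_le_cmod)
    also have "\<dots> = dist (pt z) x"
      unfolding dist_pt t(1) using u by (simp add: norm_mult norm_minus_commute)
    finally show "dist (pt z) (pt ?y) \<le> dist (pt z) x" .
  qed
qed

lemma reflect_normal_line:
  fixes u z :: complex
  assumes "cmod u = 1"
  shows "reflect (normal_line u p) (pt z) = pt (2 * of_real p * u - u\<^sup>2 * cnj z)"
proof -
  have "2 * (z + of_real (p - Re (cnj u * z)) * u) - z = z + 2 * of_real p * u - (cnj u * z + u * cnj z) * u"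
    by (simp add: complex_eq_iff algebra_simps)
  also have "\<dots> = 2 * of_real p * u - u\<^sup>2 * cnj z + (1 - u * cnj u) * z"
    by (simp add: algebra_simps power2_eq_square)
  finally have "2 * (z + of_real (p - Re (cnj u * z)) * u) - z = 2 * of_real p * u - u\<^sup>2 * cnj z"
    by (simp add: unit_mult_cnj[OF assms])
  moreover have "2 *\<^sub>R pt y - pt z = pt (2 * y - z)" for y
    by (simp add: pt_def)
  ultimately show ?thesis
    unfolding reflect_def closest_point_normal_line[OF assms] by simp
qed

lemma reflect_image_normal_line:
  fixes u v :: complex
  assumes u: "cmod u = 1"
  shows "reflect (normal_line u p) ` normal_line v r = normal_line (u\<^sup>2 * cnj v) (2 * p * Re (cnj u * v) - r)"
proof -
  define \<rho> where "\<rho> z = 2 * of_real p * u - u\<^sup>2 * cnj z" for z :: complex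
  have inv: "\<rho> (\<rho> z) = z" for z
  proof -
    have "\<rho> (\<rho> z) = 2 * of_real p * u * (1 - u * cnj u) + (u * cnj u)\<^sup>2 * z"
      by (simp add: \<rho>_def algebra_simps power2_eq_square)
    then show ?thesis by (simp add: unit_mult_cnj[OF u])
  qed
  have off: "Re (cnj v * \<rho> z) = 2 * p * Re (cnj u * v) - Re (cnj (u\<^sup>2 * cnj v) * z)" for z
    by (simp add: \<rho>_def algebra_simps power2_eq_square)
  have "P \<in> reflect (normal_line u p) ` normal_line v r \<longleftrightarrow> (\<exists>z. P = pt (\<rho> z) \<and> Re (cnj v * z) = r)" for P
    unfolding normal_line_def[of v r] \<rho>_def reflect_normal_line[OF u, symmetric] by blast
  moreover have "(\<exists>z. P = pt (\<rho> z) \<and> Re (cnj v * z) = r) \<longleftrightarrow>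
      (\<exists>z. P = pt z \<and> Re (cnj v * \<rho> z) = r)" for P
    using inv by metis
  ultimately have "P \<in> reflect (normal_line u p) ` normal_line v r \<longleftrightarrow>
      P \<in> normal_line (u\<^sup>2 * cnj v) (2 * p * Re (cnj u * v) - r)" for P
    unfolding normal_line_def[of "u\<^sup>2 * cnj v"] off by (auto simp del: cnj.simps)
  then show ?thesis by blast
qed

text \<open>
  The sign ambiguity of the unit normal; it is the source of the two branches \<open>\<sigma> = \<plusminus>1\<close> of the double
  fold.  For the nontrivial direction, a line determines its normal up to sign because the points
  \<open>p * u + \<i> * t * u\<close> run along it.
\<close>

lemma normal_line_eq_iff:
  fixes u v :: complex
  assumes "cmod u = 1" "cmod v = 1"
  shows "normal_line u p = normal_line v r \<longleftrightarrow> (\<exists>\<sigma>\<in>{1, -1::real}. v = \<sigma> * u \<and> r = \<sigma> * p)"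
proof
  assume eq: "normal_line u p = normal_line v r"
  have on: "Re (cnj v * (p * u + \<i> * t * u)) = r" for t :: real
  proof -
    have "cnj u * (p * u + \<i> * t * u) = cnj u * u * (p + \<i> * t)"
      by (simp add: algebra_simps)
    also have "\<dots> = p + \<i> * t" by (simp add: unit_mult_cnj[OF assms(1)])
    finally have "cnj u * (p * u + \<i> * t * u) = p + \<i> * t" .
    then have "pt (p * u + \<i> * t * u) \<in> normal_line u p" by simp
    then show ?thesis unfolding eq by (simp only: pt_in_normal_line)
  qed
  define k where "k = cnj v * u"
  have k: "p * Re k - t * Im k = r" for t
    using on[of t] by (simp add: k_def algebra_simps)
  have "Im k = 0" using k[of 0] k[of 1] by simp
  moreover have "cmod k = 1" using assms by (simp add: k_def norm_mult)
  ultimately have "\<bar>Re k\<bar> = 1" by (simp add: cmod_eq_Re)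
  then have re: "Re k \<in> {1, -1}" by auto
  have "k = of_real (Re k)" using \<open>Im k = 0\<close> by (simp add: complex_eq_iff)
  moreover have "v * k = u"
    by (simp only: k_def mult.assoc[symmetric] unit_mult_cnj(1)[OF assms(2)] mult_1)
  ultimately have "u = v * of_real (Re k)" by simp
  then have "v = of_real (Re k) * u" using re by (auto simp del: of_real_Re)
  with re show "\<exists>\<sigma>\<in>{1, -1::real}. v = \<sigma> * u \<and> r = \<sigma> * p"
    using k[of 0] by (intro bexI[of _ "Re k"]) (simp_all add: mult.commute)
next
  assume "\<exists>\<sigma>\<in>{1, -1::real}. v = \<sigma> * u \<and> r = \<sigma> * p"
  then consider "v = u" "r = p" | "v = - u" "r = - p" by auto
  then show "normal_line u p = normal_line v r"
    by cases (simp_all only: normal_line_eq_hyperplane pt_minus inner_minus_left neg_equal_iff_equal)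
qed

section \<open>Constructible points and lines\<close>

definition constructible_point :: "real set \<Rightarrow> point \<Rightarrow> bool" where
  "constructible_point E P \<longleftrightarrow> (\<exists>Ps Ls. origami_stage E Ps Ls \<and> P \<in> Ps)"

definition constructible_line :: "real set \<Rightarrow> line \<Rightarrow> bool" where
  "constructible_line E l \<longleftrightarrow> (\<exists>Ps Ls. origami_stage E Ps Ls \<and> l \<in> Ls)"

lemma alignments_mono:
  assumes "X \<subseteq> X'" "Y \<subseteq> Y'"
  shows "alignments X Y \<subseteq> alignments X' Y'"
  unfolding alignments_def
  by (intro Un_mono Collect_mono impI; elim exE conjE; intro exI conjI;
      (assumption | erule subsetD[OF assms(1)] | erule subsetD[OF assms(2)]))

lemma alignmentsI:
  "p \<in> X \<Longrightarrow> m \<in> Y \<Longrightarrow> (\<lambda>f. p f \<in> m f) \<in> alignments X Y"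
  "m \<in> Y \<Longrightarrow> n \<in> Y \<Longrightarrow> (\<lambda>f. m f = n f) \<in> alignments X Y"
  unfolding alignments_def
  by (rule UnI1, rule UnI2, rule CollectI, intro exI conjI, rule refl, assumption+)
     (rule UnI2, rule CollectI, intro exI conjI, rule refl, assumption+)

lemma fold_objects_mono:
  "Ps \<subseteq> Ps' \<Longrightarrow> one_fold_points Ps \<subseteq> one_fold_points Ps'"
  "Ls \<subseteq> Ls' \<Longrightarrow> one_fold_lines Ls \<subseteq> one_fold_lines Ls'"
  "Ps \<subseteq> Ps' \<Longrightarrow> two_fold_points Ps \<subseteq> two_fold_points Ps'"
  "Ls \<subseteq> Ls' \<Longrightarrow> two_fold_lines Ls \<subseteq> two_fold_lines Ls'"
  unfolding one_fold_points_def one_fold_lines_def two_fold_points_def two_fold_lines_def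
    Setcompr_eq_image
  by (assumption | rule Un_mono image_mono subset_refl)+

lemma fold_objectsI:
  "P \<in> Ps \<Longrightarrow> (\<lambda>l. P) \<in> one_fold_points Ps"
  "L \<in> Ls \<Longrightarrow> (\<lambda>l. L) \<in> one_fold_lines Ls"
  "(\<lambda>l. l) \<in> one_fold_lines Ls"
  "L \<in> Ls \<Longrightarrow> (\<lambda>l. reflect l ` L) \<in> one_fold_lines Ls"
  "P \<in> Ps \<Longrightarrow> (\<lambda>(a, b). reflect a P) \<in> two_fold_points Ps"
  "P \<in> Ps \<Longrightarrow> (\<lambda>(a, b). reflect b P) \<in> two_fold_points Ps"
  "L \<in> Ls \<Longrightarrow> (\<lambda>(a, b). L) \<in> two_fold_lines Ls"
  "L \<in> Ls \<Longrightarrow> (\<lambda>(a, b). reflect a ` L) \<in> two_fold_lines Ls"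
  "(\<lambda>(a, b). reflect b ` a) \<in> two_fold_lines Ls"
proof -
  have CollectI': "z = f x \<Longrightarrow> P x \<Longrightarrow> z \<in> {f x | x. P x}" for z P x and f :: "'c \<Rightarrow> 'd"
    by blast
  show "P \<in> Ps \<Longrightarrow> (\<lambda>l. P) \<in> one_fold_points Ps"
    unfolding one_fold_points_def by (rule UnI1, rule CollectI'[OF refl])
  show "L \<in> Ls \<Longrightarrow> (\<lambda>l. L) \<in> one_fold_lines Ls"
    unfolding one_fold_lines_def by (rule UnI1, rule UnI1, rule CollectI'[OF refl])
  show "(\<lambda>l. l) \<in> one_fold_lines Ls"
    unfolding one_fold_lines_def by (rule UnI1, rule UnI2, rule singletonI)
  show "L \<in> Ls \<Longrightarrow> (\<lambda>l. reflect l ` L) \<in> one_fold_lines Ls"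
    unfolding one_fold_lines_def by (rule UnI2, rule CollectI'[OF refl])
  show "P \<in> Ps \<Longrightarrow> (\<lambda>(a, b). reflect a P) \<in> two_fold_points Ps"
    unfolding two_fold_points_def by (rule UnI1, rule UnI2, rule CollectI'[OF refl])
  show "P \<in> Ps \<Longrightarrow> (\<lambda>(a, b). reflect b P) \<in> two_fold_points Ps"
    unfolding two_fold_points_def by (rule UnI2, rule CollectI'[OF refl])
  show "L \<in> Ls \<Longrightarrow> (\<lambda>(a, b). L) \<in> two_fold_lines Ls"
    unfolding two_fold_lines_def
    by (rule UnI1, rule UnI1, rule UnI1, rule UnI1, rule CollectI'[OF refl])
  show "L \<in> Ls \<Longrightarrow> (\<lambda>(a, b). reflect a ` L) \<in> two_fold_lines Ls"
    unfolding two_fold_lines_def by (rule UnI1, rule UnI1, rule UnI2, rule CollectI'[OF refl])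
  show "(\<lambda>(a, b). reflect b ` a) \<in> two_fold_lines Ls"
    unfolding two_fold_lines_def by (rule UnI2, rule insertI1)
qed

lemma start_subset_stage:
  "origami_stage E Ps Ls \<Longrightarrow> {(0, 0), (1, 0), (0, 1)} \<union> {(s, 0) | s. s \<in> E} \<subseteq> Ps"
  by (induction rule: origami_stage.induct) (rule subset_refl | assumption | erule subset_insertI2)+

text \<open>
  A construction can be replayed on top of another one from the same data: more available objects only
  admit more alignments, and the solution set of a given set of alignments does not change.  Hence
  objects constructed separately may be used together, and it suffices to speak of constructible
  points and lines without mentioning stages.
\<close>

lemma origami_stage_Un:
  assumes "origami_stage E Ps Ls" and S: "origami_stage E Qs Ms"
  shows "origami_stage E (Ps \<union> Qs) (Ls \<union> Ms)"
  using assms(1)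
proof (induction rule: origami_stage.induct)
  case start
  have "{(0, 0), (1, 0), (0, 1)} \<union> {(s, 0) | s. s \<in> E} \<union> Qs = Qs"
    using start_subset_stage[OF S] by blast
  with S show ?case by simp
next
  case (intersection Ps Ls L M P)
  then show ?case using origami_stage.intersection[of E "Ps \<union> Qs" "Ls \<union> Ms" L M P] by simp
next
  case (reflect_point Ps Ls l P)
  then show ?case using origami_stage.reflect_point[of E "Ps \<union> Qs" "Ls \<union> Ms" l P] by simp
next
  case (reflect_line Ps Ls l L)
  then show ?case using origami_stage.reflect_line[of E "Ps \<union> Qs" "Ls \<union> Ms" l L] by simp
next
  case (one_fold Ps Ls A l)
  have "A \<subseteq> alignments (one_fold_points (Ps \<union> Qs)) (one_fold_lines (Ls \<union> Ms))"
    using one_fold.hyps(3) alignments_mono fold_objects_mono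
    by (meson Un_upper1 order_trans)
  then show ?case
    using origami_stage.one_fold[OF one_fold.IH one_fold.hyps(2) _ one_fold.hyps(4,5)] by simp
next
  case (two_fold Ps Ls A a b)
  have "A \<subseteq> alignments (two_fold_points (Ps \<union> Qs)) (two_fold_lines (Ls \<union> Ms))"
    using two_fold.hyps(3) alignments_mono fold_objects_mono
    by (meson Un_upper1 order_trans)
  then show ?case
    using origami_stage.two_fold[OF two_fold.IH two_fold.hyps(2) _ two_fold.hyps(4,5)] by simp
qed

lemma common_stage:
  assumes "finite X" "\<forall>P\<in>X. constructible_point E P" "finite Y" "\<forall>l\<in>Y. constructible_line E l"
  obtains Ps Ls where "origami_stage E Ps Ls" "X \<subseteq> Ps" "Y \<subseteq> Ls"
proof -
  have start: "\<exists>Ps Ls. origami_stage E Ps Ls"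
    by (intro exI) (rule origami_stage.start)
  have merge: "\<exists>Ps Ls. origami_stage E Ps Ls \<and> (S \<union> T \<subseteq> Ps) \<and> (S' \<union> T' \<subseteq> Ls)"
    if "\<exists>Ps Ls. origami_stage E Ps Ls \<and> S \<subseteq> Ps \<and> S' \<subseteq> Ls"
      "\<exists>Ps Ls. origami_stage E Ps Ls \<and> T \<subseteq> Ps \<and> T' \<subseteq> Ls" for S T S' T'
  proof -
    from that obtain Ps Ls Qs Ms where "S \<subseteq> Ps" "S' \<subseteq> Ls" "T \<subseteq> Qs" "T' \<subseteq> Ms"
      and "origami_stage E Ps Ls" "origami_stage E Qs Ms"
      by (elim exE conjE)
    then show ?thesis
      by (intro exI[of _ "Ps \<union> Qs"] exI[of _ "Ls \<union> Ms"]) (auto intro: origami_stage_Un)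
  qed
  have "\<exists>Ps Ls. origami_stage E Ps Ls \<and> X \<subseteq> Ps \<and> {} \<subseteq> Ls"
    using assms(1,2)
  proof (induction X rule: finite_induct)
    case (insert P X)
    have "\<exists>Ps Ls. origami_stage E Ps Ls \<and> {P} \<subseteq> Ps \<and> {} \<subseteq> Ls"
      using insert.prems by (simp add: constructible_point_def)
    from merge[OF this insert.IH] insert.prems show ?case by simp
  qed (use start in simp)
  moreover have "\<exists>Ps Ls. origami_stage E Ps Ls \<and> {} \<subseteq> Ps \<and> Y \<subseteq> Ls"
    using assms(3,4)
  proof (induction Y rule: finite_induct)
    case (insert l Y)
    have "\<exists>Ps Ls. origami_stage E Ps Ls \<and> {} \<subseteq> Ps \<and> {l} \<subseteq> Ls"
      using insert.prems by (simp add: constructible_line_def)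
    from merge[OF this insert.IH] insert.prems show ?case by simp
  qed (use start in simp)
  ultimately have "\<exists>Ps Ls. origami_stage E Ps Ls \<and> X \<union> {} \<subseteq> Ps \<and> {} \<union> Y \<subseteq> Ls"
    by (rule merge)
  then show ?thesis using that by auto
qed

lemma constructible_point_start:
  "constructible_point E (pt 0)" "constructible_point E (pt 1)" "constructible_point E (pt \<i>)" "s \<in> E \<Longrightarrow> constructible_point E (pt (of_real s))"
proof -
  have "constructible_point E P" if "P \<in> {(0, 0), (1, 0), (0, 1)} \<union> {(s, 0) | s. s \<in> E}" for P
    using origami_stage.start[of E] that unfolding constructible_point_def by blast
  from this[of "pt 0"] this[of "pt 1"] this[of "pt \<i>"] this[of "pt (of_real s)"]
  show "constructible_point E (pt 0)" "constructible_point E (pt 1)" "constructible_point E (pt \<i>)" "s \<in> E \<Longrightarrow> constructible_point E (pt (of_real s))"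
    by (simp_all add: pt_def)
qed

lemma constructible_point_intersection:
  assumes "constructible_line E L" "constructible_line E M" "L \<inter> M = {P}"
  shows "constructible_point E P"
proof -
  obtain Ps Ls where "origami_stage E Ps Ls" "{L, M} \<subseteq> Ls"
    using common_stage[of "{}" E "{L, M}"] assms by auto
  then show ?thesis
    using origami_stage.intersection[of E Ps Ls L M P] assms(3) unfolding constructible_point_def by blast
qed

lemma constructible_point_reflect:
  fixes u z :: complex
  assumes "constructible_line E (normal_line u p)" "constructible_point E (pt z)" "cmod u = 1"
  shows "constructible_point E (pt (2 * of_real p * u - u\<^sup>2 * cnj z))"
proof -
  obtain Ps Ls where "origami_stage E Ps Ls" "{pt z} \<subseteq> Ps" "{normal_line u p} \<subseteq> Ls"
    using common_stage[of "{pt z}" E "{normal_line u p}"] assms(1,2) by auto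
  then show ?thesis
    using origami_stage.reflect_point[of E Ps Ls "normal_line u p" "pt z"] reflect_normal_line[OF assms(3)]
    unfolding constructible_point_def by fastforce
qed

lemma constructible_line_join:
  assumes "constructible_point E (pt z)" "constructible_point E (pt w)" "z \<noteq> w"
    and "cmod u = 1" "Re (cnj u * z) = p" "Re (cnj u * w) = p"
  shows "constructible_line E (normal_line u p)"
proof -
  obtain Ps Ls where S: "origami_stage E Ps Ls" "{pt z, pt w} \<subseteq> Ps"
    using common_stage[of "{pt z, pt w}" E "{}"] assms(1,2) by auto
  define A where "A = {(\<lambda>l. pt z \<in> l), (\<lambda>l. pt w \<in> l)}"
  have "A \<subseteq> alignments (one_fold_points Ps) (one_fold_lines Ls)"
    using alignmentsI(1)[OF fold_objectsI(1,3)] S(2) by (simp add: A_def)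
  \<comment> \<open>Both have dimension one, so the inclusion of the hull is an equality.\<close>
  have hull: "l = affine hull {pt z, pt w}" if "is_line l" "pt z \<in> l" "pt w \<in> l" for l
  proof (rule affine_dim_equal[symmetric])
    show "affine hull {pt z, pt w} \<subseteq> l"
      using that by (intro hull_minimal) (auto simp: is_line_def)
    show "aff_dim (affine hull {pt z, pt w}) = aff_dim l"
      using that assms(3) by (simp add: is_line_def aff_dim_2)
  qed (use that in \<open>auto simp: is_line_def\<close>)
  have "one_fold_solutions A \<subseteq> {affine hull {pt z, pt w}}"
    using hull by (auto simp: one_fold_solutions_def A_def)
  then have "finite (one_fold_solutions A)" by (rule finite_subset) simp
  moreover have "normal_line u p \<in> one_fold_solutions A"
    using assms is_line_iff_normal_line by (auto simp del: cnj.simps simp: one_fold_solutions_def A_def)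
  moreover have "finite A" by (simp add: A_def)
  ultimately show ?thesis
    using origami_stage.one_fold[OF S(1) _ \<open>A \<subseteq> _\<close>] unfolding constructible_line_def by blast
qed

text \<open>
  The fold is required to pass through \<open>z\<close> and to map the given line to itself.  Besides the
  perpendicular, the given line is also a solution if it contains \<open>z\<close>; so the solution need not be
  unique, but its normal is one of \<open>\<plusminus>u\<close>, \<open>\<plusminus>\<i> * u\<close>.
\<close>

lemma constructible_line_perpendicular:
  assumes "constructible_line E (normal_line u p)" "constructible_point E (pt z)" and u: "cmod u = 1"
  shows "constructible_line E (normal_line (\<i> * u) (Re (cnj (\<i> * u) * z)))"
proof -
  obtain Ps Ls where S: "origami_stage E Ps Ls" "{pt z} \<subseteq> Ps" "{normal_line u p} \<subseteq> Ls"
    using common_stage[of "{pt z}" E "{normal_line u p}"] assms by auto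
  define A where "A = {(\<lambda>l. pt z \<in> l), (\<lambda>l. reflect l ` normal_line u p = normal_line u p)}"
  have "A \<subseteq> alignments (one_fold_points Ps) (one_fold_lines Ls)"
    using alignmentsI(1)[OF fold_objectsI(1,3)] alignmentsI(2)[OF fold_objectsI(4,2)] S(2,3)
    by (simp add: A_def)
  have "one_fold_solutions A \<subseteq> (\<lambda>v. normal_line v (Re (cnj v * z))) ` {u, - u, \<i> * u, - \<i> * u}"
  proof
    fix l assume "l \<in> one_fold_solutions A"
    then obtain v r where v: "cmod v = 1" "l = normal_line v r" "Re (cnj v * z) = r"
        and r: "reflect (normal_line v r) ` normal_line u p = normal_line u p"
      by (auto simp del: cnj.simps simp: one_fold_solutions_def A_def is_line_iff_normal_line)
    have "cmod (v\<^sup>2 * cnj u) = 1" using u v by (simp add: norm_mult norm_power)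
    from r[unfolded reflect_image_normal_line[OF v(1)] normal_line_eq_iff[OF this u]]
    have "u = v\<^sup>2 * cnj u \<or> u = - (v\<^sup>2 * cnj u)"
      by (simp only: bex_simps empty_iff insert_iff of_real_1 of_real_minus mult_1 mult_minus1) blast
    then have "v\<^sup>2 * cnj u = u \<or> v\<^sup>2 * cnj u = - u"
      by (metis minus_minus)
    then have "v\<^sup>2 * (cnj u * u) = u\<^sup>2 \<or> v\<^sup>2 * (cnj u * u) = - u\<^sup>2"
      by (auto simp: power2_eq_square algebra_simps)
    then have "v\<^sup>2 = u\<^sup>2 \<or> v\<^sup>2 = (\<i> * u)\<^sup>2"
      by (simp add: unit_mult_cnj[OF u] power_mult_distrib)
    then have "v \<in> {u, - u, \<i> * u, - \<i> * u}" by (auto simp: power2_eq_iff)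
    with v show "l \<in> (\<lambda>v. normal_line v (Re (cnj v * z))) ` {u, - u, \<i> * u, - \<i> * u}"
      by blast
  qed
  then have "finite (one_fold_solutions A)" by (rule finite_subset) simp
  moreover have "normal_line (\<i> * u) (Re (cnj (\<i> * u) * z)) \<in> one_fold_solutions A"
  proof -
    have iu: "cmod (\<i> * u) = 1" using u by (simp add: norm_mult)
    have "(\<i> * u)\<^sup>2 * cnj u = - u * (u * cnj u)"
      by (simp add: power2_eq_square algebra_simps)
    then have "(\<i> * u)\<^sup>2 * cnj u = - u" by (simp add: unit_mult_cnj[OF u])
    then have "reflect (normal_line (\<i> * u) r) ` normal_line u p = normal_line u p" for r
      unfolding reflect_image_normal_line[OF iu]
      using u by (subst normal_line_eq_iff) (auto intro!: bexI[of _ "-1::real"])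
    then show ?thesis
      using iu is_line_iff_normal_line
      by (auto simp del: cnj.simps simp: one_fold_solutions_def A_def)
  qed
  moreover have "finite A" by (simp add: A_def)
  ultimately show ?thesis
    using origami_stage.one_fold[OF S(1) _ \<open>A \<subseteq> _\<close>] unfolding constructible_line_def by blast
qed

lemma constructible_line_x_axis: "constructible_line E (normal_line \<i> 0)"
  by (rule constructible_line_join[of E 0 1]) (simp_all add: constructible_point_start)

lemma constructible_line_y_axis: "constructible_line E (normal_line 1 0)"
  by (rule constructible_line_join[of E 0 \<i>]) (simp_all add: constructible_point_start)

lemma constructible_line_vertical:
  assumes "constructible_point E (pt z)"
  shows "constructible_line E (normal_line (-1) (- Re z))"
  using constructible_line_perpendicular[OF constructible_line_x_axis assms] by simp

lemma constructible_line_horizontal: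
  assumes "constructible_point E (pt z)"
  shows "constructible_line E (normal_line \<i> (Im z))"
  using constructible_line_perpendicular[OF constructible_line_y_axis assms] by simp

lemma constructible_point_combine:
  assumes "constructible_point E (pt z)" "constructible_point E (pt w)"
  shows "constructible_point E (pt (Complex (Re z) (Im w)))"
proof (rule constructible_point_intersection[OF constructible_line_vertical[OF assms(1)] constructible_line_horizontal[OF assms(2)]])
  show "normal_line (-1) (- Re z) \<inter> normal_line \<i> (Im w) = {pt (Complex (Re z) (Im w))}"
    by (auto simp: normal_line_def complex_eq_iff)
qed

text \<open>Reflection in the diagonal, which joins the origin with \<open>1 + \<i>\<close>; it moves data from one axis to the other.\<close>

lemma constructible_point_swap:
  assumes "constructible_point E (pt z)"
  shows "constructible_point E (pt (Complex (Im z) (Re z)))"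
proof -
  define d where "d = Complex (1 / sqrt 2) (- 1 / sqrt 2)"
  have d: "cmod d = 1" by (simp add: d_def cmod_def power_divide)
  have "constructible_point E (pt (Complex 1 1))"
    using constructible_point_combine[OF constructible_point_start(2,3)] by simp
  then have "constructible_line E (normal_line d 0)"
    by (intro constructible_line_join[of E 0 "Complex 1 1"] constructible_point_start d) (auto simp: d_def complex_eq_iff)
  from constructible_point_reflect[OF this assms d] have "constructible_point E (pt (- d\<^sup>2 * cnj z))" by simp
  moreover have "d\<^sup>2 = - \<i>"
    by (simp add: d_def complex_eq_iff power2_eq_square)
  then have "- d\<^sup>2 * cnj z = Complex (Im z) (Re z)" by (simp add: complex_eq_iff)
  ultimately show ?thesis by simp
qed

lemma two_fold_constructible_coordinates:
  assumes "constructible_point E (pt z)"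
  shows "two_fold_constructible E (Re z)" "two_fold_constructible E (Im z)"
proof -
  have "constructible_point E (pt (Complex (Re w) 0))" if "constructible_point E (pt w)" for w
    using constructible_point_combine[OF that constructible_point_start(1)] by simp
  from this[OF assms] this[OF constructible_point_swap[OF assms]]
  show "two_fold_constructible E (Re z)" "two_fold_constructible E (Im z)"
    by (simp_all add: constructible_point_def two_fold_constructible_def pt_def)
qed

section \<open>The double fold\<close>

definition septisection_folds :: "line \<Rightarrow> line \<Rightarrow> line \<Rightarrow> bool" where
  "septisection_folds n a b \<longleftrightarrow>
     reflect b ` a = reflect a ` normal_line 1 0 \<and> reflect a (pt 1) \<in> normal_line 1 0 \<and> reflect b (pt (-1)) \<in> n"

text \<open>
  The three conditions in terms of normals and offsets.  The fold of \<open>a\<close> along \<open>b\<close> has normal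
  \<open>w\<^sup>2 * cnj u\<close> and the fold of the imaginary axis along \<open>a\<close> has normal \<open>u\<^sup>2\<close>, so equality of the lines
  gives \<open>w\<^sup>2 = \<sigma> * u ^ 3\<close> together with an equation between the offsets.
\<close>

lemma septisection_folds_iff:
  fixes u w m :: complex
  assumes u: "cmod u = 1" and w: "cmod w = 1"
  shows "septisection_folds (normal_line m (Re m)) (normal_line u p) (normal_line w q) \<longleftrightarrow>
    (\<exists>\<sigma>\<in>{1, -1::real}. w\<^sup>2 = \<sigma> * u ^ 3 \<and> 2 * q * Re (cnj u * w) - p = \<sigma> * (2 * p * Re u)) \<and>
    2 * p * Re u = 2 * (Re u)\<^sup>2 - 1 \<and>
    Re (cnj m * (2 * of_real q * w + w\<^sup>2)) = Re m"
proof -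
  have ww: "w\<^sup>2 * cnj u = \<sigma> * u\<^sup>2 \<longleftrightarrow> w\<^sup>2 = \<sigma> * u ^ 3" for \<sigma> :: complex
  proof
    assume "w\<^sup>2 * cnj u = \<sigma> * u\<^sup>2"
    then have "w\<^sup>2 * (cnj u * u) = \<sigma> * u ^ 3" by (simp add: power3_eq_cube power2_eq_square algebra_simps)
    then show "w\<^sup>2 = \<sigma> * u ^ 3" by (simp add: unit_mult_cnj[OF u])
  next
    assume "w\<^sup>2 = \<sigma> * u ^ 3"
    then have "w\<^sup>2 * cnj u = \<sigma> * u\<^sup>2 * (u * cnj u)" by (simp add: power3_eq_cube power2_eq_square algebra_simps)
    then show "w\<^sup>2 * cnj u = \<sigma> * u\<^sup>2" by (simp add: unit_mult_cnj[OF u])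
  qed
  have 1: "reflect (normal_line u p) ` normal_line 1 0 = normal_line (u\<^sup>2) (2 * p * Re u)"
    using reflect_image_normal_line[OF u, of p 1 0] by simp
  have 2: "reflect (normal_line w q) ` normal_line u p = normal_line (w\<^sup>2 * cnj u) (2 * q * Re (cnj u * w) - p)"
    using reflect_image_normal_line[OF w, of q u p] by (simp add: mult.commute)
  have "reflect (normal_line w q) ` normal_line u p = reflect (normal_line u p) ` normal_line 1 0 \<longleftrightarrow>
    (\<exists>\<sigma>\<in>{1, -1::real}. w\<^sup>2 = \<sigma> * u ^ 3 \<and> 2 * q * Re (cnj u * w) - p = \<sigma> * (2 * p * Re u))"
  proof -
    have "reflect (normal_line w q) ` normal_line u p = reflect (normal_line u p) ` normal_line 1 0 \<longleftrightarrow>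
        normal_line (u\<^sup>2) (2 * p * Re u) = normal_line (w\<^sup>2 * cnj u) (2 * q * Re (cnj u * w) - p)"
      unfolding 1 2 by (rule eq_commute)
    also have "\<dots> \<longleftrightarrow> (\<exists>\<sigma>\<in>{1, -1::real}. w\<^sup>2 * cnj u = \<sigma> * u\<^sup>2 \<and>
        2 * q * Re (cnj u * w) - p = \<sigma> * (2 * p * Re u))"
      using u w by (intro normal_line_eq_iff) (simp_all add: norm_mult norm_power)
    finally show ?thesis by (simp only: ww)
  qed
  moreover have "reflect (normal_line u p) (pt 1) \<in> normal_line 1 0 \<longleftrightarrow> 2 * p * Re u = 2 * (Re u)\<^sup>2 - 1"
    using unit_mult_cnj(3)[OF u] by (auto simp: reflect_normal_line[OF u] power2_eq_square)
  moreover have "reflect (normal_line w q) (pt (-1)) \<in> normal_line m (Re m) \<longleftrightarrow>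
      Re (cnj m * (2 * of_real q * w + w\<^sup>2)) = Re m"
    by (simp add: reflect_normal_line[OF w] del: cnj.simps times_complex.simps)
  ultimately show ?thesis unfolding septisection_folds_def by blast
qed

lemma of_real_two_Re: "complex_of_real (2 * Re z) = z + cnj z"
  by (simp add: complex_add_cnj)

lemma two_Re_cnj_mult_units:
  fixes u w :: complex
  assumes "cmod u = 1" "cmod w = 1"
  shows "u * w * complex_of_real (2 * Re (cnj u * w)) = w\<^sup>2 + u\<^sup>2"
proof -
  have "u * w * complex_of_real (2 * Re (cnj u * w)) = (u * cnj u) * w\<^sup>2 + u\<^sup>2 * (w * cnj w)"
    unfolding of_real_two_Re complex_cnj_mult complex_cnj_cnj
    by (simp add: algebra_simps power2_eq_square)
  then show ?thesis by (simp only: unit_mult_cnj[OF assms(1)] unit_mult_cnj[OF assms(2)] mult_1 mult_1_right)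
qed

text \<open>
  Elimination of the offsets.  On the unit circle conjugation is inversion, so all equations become
  rational in \<open>u\<close>, \<open>w\<close>, \<open>m\<close>.  The assumptions on \<open>p\<close> and \<open>q\<close> determine both offsets; after they are
  inserted, \<open>w\<close> occurs only through \<open>w\<^sup>2 = \<sigma> * u ^ 3\<close>, and the remaining polynomial in \<open>u\<close> has the
  common factor \<open>u\<^sup>2 + \<sigma> * u + 1\<close>, with the cofactor
  \<open>(u ^ 4 + 1) * (\<sigma> * u ^ 3 + m\<^sup>2) + \<sigma> * (u ^ 4 - 1) * (u ^ 3 - \<sigma> * m\<^sup>2) = 2 * \<sigma> * (u ^ 7 + \<sigma> * m\<^sup>2)\<close>.
  The equivalence serves two purposes: one direction bounds the number of double folds, the other
  one shows that the desired double fold exists.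
\<close>

lemma septic_equation:
  fixes u w m :: complex and p q \<sigma> :: real
  assumes u: "cmod u = 1" and w: "cmod w = 1" and m: "cmod m = 1" and \<sigma>: "\<sigma> \<in> {1, -1}"
    and c: "Re u \<noteq> 0" and \<kappa>: "Re (cnj u * w) \<noteq> 0"
    and p: "2 * p * Re u = 2 * (Re u)\<^sup>2 - 1"
    and w2: "w\<^sup>2 = \<sigma> * u ^ 3"
    and q: "2 * q * Re (cnj u * w) - p = \<sigma> * (2 * p * Re u)"
  shows "Re (cnj m * (2 * of_real q * w + w\<^sup>2)) = Re m \<longleftrightarrow> (u\<^sup>2 + \<sigma> * u + 1) * (u ^ 7 + \<sigma> * m\<^sup>2) = 0"
proof -
  define s :: complex where "s = of_real \<sigma>"
  have s2: "s * s = 1" using \<sigma> by (auto simp: s_def)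
  define U W M where "U = cnj u" and "W = cnj w" and "M = cnj m"
  have inv: "u * U = 1" "w * W = 1" "m * M = 1"
    using unit_mult_cnj(1) u w m by (simp_all add: U_def W_def M_def)
  then have nz: "u \<noteq> 0" "w \<noteq> 0" "m \<noteq> 0" by auto
  note re = of_real_two_Re
  have ww: "w\<^sup>2 = s * u ^ 3" using w2 by (simp add: s_def)
  have c': "u\<^sup>2 + 1 \<noteq> 0"
  proof -
    have "u * complex_of_real (2 * Re u) = u * u + u * U"
      unfolding re U_def by (rule distrib_left)
    also have "\<dots> = u\<^sup>2 + 1" by (simp add: inv power2_eq_square)
    finally show ?thesis using c nz by auto
  qed
  have \<kappa>': "s * u + 1 \<noteq> 0"
  proof -
    have "u * w * complex_of_real (2 * Re (cnj u * w)) = u\<^sup>2 * (s * u + 1)"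
      unfolding two_Re_cnj_mult_units[OF u w] ww
      by (simp add: algebra_simps power2_eq_square power3_eq_cube)
    then show ?thesis
      using \<kappa> nz by (auto simp del: cnj.simps times_complex.simps)
  qed
  \<comment> \<open>The offsets, with denominators cleared; the two facts above say that these denominators,
    up to units the double cosines of the arguments of \<open>u\<close> and \<open>w / u\<close>, do not vanish.\<close>
  have P: "2 * p * u * (u\<^sup>2 + 1) = u ^ 4 + 1"
  proof -
    have "2 * p * (2 * Re u) = (2 * Re u)\<^sup>2 - 2" using p by (simp add: power2_eq_square)
    from arg_cong[OF this, of complex_of_real]
    have "2 * p * (u + U) = (u + U)\<^sup>2 - 2"
      unfolding U_def re[symmetric] by simp
    with inv(1) show ?thesis by algebra
  qed
  have Q: "q * u\<^sup>2 * (s * u + 1) = s * p * w * (u\<^sup>2 + s * u + 1)"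
  proof -
    define X Y where "X = 2 * Re (cnj u * w)" and "Y = 2 * Re u"
    have "q * X - p = \<sigma> * (p * Y)" using q by (simp only: X_def Y_def mult_ac)
    from arg_cong[OF this, of complex_of_real]
    have "of_real q * of_real X - of_real p = s * (of_real p * of_real Y)" by (simp add: s_def)
    moreover have "of_real X = U * w + u * W" unfolding X_def re by (simp add: U_def W_def)
    moreover have "of_real Y = u + U" unfolding Y_def re U_def ..
    ultimately have "of_real q * (U * w + u * W) - of_real p = s * (of_real p * (u + U))" by (simp only:)
    then have "u * w * (q * (U * w + u * W) - p) = u * w * (s * (p * (u + U)))" by simp
    moreover have "u * w * (q * (U * w + u * W) - p) =
        q * ((u * U) * w\<^sup>2 + u\<^sup>2 * (w * W)) - p * u * w"
      by (simp add: algebra_simps power2_eq_square)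
    moreover have "u * w * (s * (p * (u + U))) = s * p * w * (u\<^sup>2 + u * U)"
      by (simp add: algebra_simps power2_eq_square)
    ultimately have "q * (s * u ^ 3 + u\<^sup>2) = p * u * w + s * p * w * (u\<^sup>2 + 1)"
      unfolding inv ww by (simp add: algebra_simps)
    then show ?thesis using s2 by algebra
  qed
  \<comment> \<open>\<open>D\<close> is twice the defect of the third condition.\<close>
  define D where "D = M * (2 * of_real q * w + w\<^sup>2) + m * (2 * of_real q * W + W\<^sup>2) - (m + M)"
  have D: "Re (cnj m * (2 * of_real q * w + w\<^sup>2)) = Re m \<longleftrightarrow> D = 0"
  proof -
    have "D = complex_of_real (2 * Re (cnj m * (2 * of_real q * w + w\<^sup>2))) - complex_of_real (2 * Re m)"
      unfolding re D_def M_def W_def by simp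
    also have "\<dots> = complex_of_real (2 * (Re (cnj m * (2 * of_real q * w + w\<^sup>2)) - Re m))"
      by (simp only: of_real_diff of_real_mult right_diff_distrib)
    finally show ?thesis by (simp only: of_real_eq_0_iff mult_eq_0_iff right_minus_eq) simp
  qed
  have Z: "m * w\<^sup>2 * D = 2 * q * w * (s * u ^ 3 + m\<^sup>2) + (u ^ 3 - s) * (u ^ 3 - s * m\<^sup>2)"
  proof -
    have "m * w\<^sup>2 * D = (m * M) * (2 * q * w * w\<^sup>2 + w\<^sup>2 * w\<^sup>2)
        + m\<^sup>2 * (2 * q * w * (w * W) + (w * W)\<^sup>2) - m\<^sup>2 * w\<^sup>2 - (m * M) * w\<^sup>2"
      by (simp add: D_def algebra_simps power2_eq_square)
    also have "\<dots> = 2 * q * w * (s * u ^ 3 + m\<^sup>2) + (s * s) * (u ^ 3 * u ^ 3) + m\<^sup>2 - (m\<^sup>2 + 1) * (s * u ^ 3)"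
      unfolding inv ww by (simp add: algebra_simps)
    also have "\<dots> = 2 * q * w * (s * u ^ 3 + m\<^sup>2) + (u ^ 3 - s) * (u ^ 3 - s * m\<^sup>2) + (1 - s * s) * (m\<^sup>2 - u ^ 3 * u ^ 3)"
      by (simp add: algebra_simps)
    finally show ?thesis by (simp add: s2)
  qed
  \<comment> \<open>Multiplying by the denominators of \<open>q\<close> and \<open>p\<close> allows to substitute \<open>Q\<close> and then \<open>P\<close>.\<close>
  have "u\<^sup>2 * (s * u + 1) * (u\<^sup>2 + 1) * (m * w\<^sup>2 * D) =
      2 * (u\<^sup>2 + 1) * w * (s * u ^ 3 + m\<^sup>2) * (q * u\<^sup>2 * (s * u + 1))
      + u\<^sup>2 * (s * u + 1) * (u\<^sup>2 + 1) * ((u ^ 3 - s) * (u ^ 3 - s * m\<^sup>2))"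
    unfolding Z by (simp add: algebra_simps)
  also have "\<dots> = 2 * (u\<^sup>2 + 1) * p * s * w\<^sup>2 * (s * u ^ 3 + m\<^sup>2) * (u\<^sup>2 + s * u + 1)
      + u\<^sup>2 * (s * u + 1) * (u\<^sup>2 + 1) * ((u ^ 3 - s) * (u ^ 3 - s * m\<^sup>2))"
    unfolding Q by (simp add: power2_eq_square[of w] mult_ac)
  also have "\<dots> = (2 * p * u * (u\<^sup>2 + 1)) * ((s * s) * u\<^sup>2 * (s * u ^ 3 + m\<^sup>2) * (u\<^sup>2 + s * u + 1))
      + u\<^sup>2 * (s * u + 1) * (u\<^sup>2 + 1) * ((u ^ 3 - s) * (u ^ 3 - s * m\<^sup>2))"
    unfolding ww by (simp add: power2_eq_square[of u] power3_eq_cube mult_ac)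
  also have "\<dots> = u\<^sup>2 * ((u ^ 4 + 1) * (s * u ^ 3 + m\<^sup>2) * (u\<^sup>2 + s * u + 1)
      + (s * u + 1) * (u\<^sup>2 + 1) * ((u ^ 3 - s) * (u ^ 3 - s * m\<^sup>2)))"
    unfolding P s2 by (simp add: algebra_simps)
  also have "\<dots> = 2 * s * u\<^sup>2 * ((u\<^sup>2 + s * u + 1) * (u ^ 7 + s * m\<^sup>2))"
  proof -
    have "(u ^ 4 + 1) * (s * u ^ 3 + m\<^sup>2) * (u\<^sup>2 + s * u + 1)
      + (s * u + 1) * (u\<^sup>2 + 1) * ((u ^ 3 - s) * (u ^ 3 - s * m\<^sup>2)) =
      2 * s * ((u\<^sup>2 + s * u + 1) * (u ^ 7 + s * m\<^sup>2))"
      using s2 by algebra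
    then show ?thesis by simp
  qed
  finally have "D = 0 \<longleftrightarrow> (u\<^sup>2 + s * u + 1) * (u ^ 7 + s * m\<^sup>2) = 0"
    using c' \<kappa>' nz s2 by auto
  then show ?thesis unfolding D s_def .
qed

text \<open>
  By the factorization \<open>u\<close> satisfies \<open>u ^ 3 = \<sigma>\<close> or \<open>u ^ 7 = - \<sigma> * m\<^sup>2\<close>; there are finitely many such
  \<open>u\<close>, at most two \<open>w\<close> for each of them, and the offsets are functions of \<open>u\<close>, \<open>w\<close> and \<open>\<sigma>\<close>.  The
  degenerate positions, in which an offset would be undetermined, contradict the fold conditions.
\<close>

lemma finite_septisection_folds:
  assumes m: "cmod m = 1"
  shows "finite {(a, b). is_line a \<and> is_line b \<and> septisection_folds (normal_line m (Re m)) a b}"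
proof -
  define p where "p u = (2 * (Re u)\<^sup>2 - 1) / (2 * Re u)" for u
  define q where "q \<sigma> u w = (p u + \<sigma> * (2 * p u * Re u)) / (2 * Re (cnj u * w))" for \<sigma> u w
  define U where "U \<sigma> = {u. u ^ 3 = complex_of_real \<sigma>} \<union> {u. u ^ 7 = - complex_of_real \<sigma> * m\<^sup>2}" for \<sigma>
  define W where "W \<sigma> u = {w. w\<^sup>2 = complex_of_real \<sigma> * u ^ 3}" for \<sigma> u
  define F where "F = (\<lambda>(\<sigma>, u, w). (normal_line u (p u), normal_line w (q \<sigma> u w))) `
      (SIGMA \<sigma>:{1, -1}. SIGMA u:U \<sigma>. W \<sigma> u)"
  have "finite F"
    unfolding F_def U_def W_def by (intro finite_imageI finite_SigmaI) (auto simp: finite_nth_roots)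
  moreover have "{(a, b). is_line a \<and> is_line b \<and> septisection_folds (normal_line m (Re m)) a b} \<subseteq> F"
  proof clarify
    fix a b assume "is_line a" "is_line b" and folds: "septisection_folds (normal_line m (Re m)) a b"
    then obtain u p' w q' where u: "cmod u = 1" "a = normal_line u p'" and w: "cmod w = 1" "b = normal_line w q'"
      by (auto simp: is_line_iff_normal_line)
    from folds[unfolded u(2) w(2) septisection_folds_iff[OF u(1) w(1)]]
    obtain \<sigma> :: real where \<sigma>: "\<sigma> \<in> {1, -1}" and w2: "w\<^sup>2 = \<sigma> * u ^ 3"
      and q': "2 * q' * Re (cnj u * w) - p' = \<sigma> * (2 * p' * Re u)"
      and p': "2 * p' * Re u = 2 * (Re u)\<^sup>2 - 1"
      and R: "Re (cnj m * (2 * of_real q' * w + w\<^sup>2)) = Re m" by blast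
    \<comment> \<open>A horizontal \<open>a\<close> maps the point \<open>1\<close> to a point with real part \<open>1\<close>, which is not on the axis.\<close>
    have c: "Re u \<noteq> 0" using p' by auto
    \<comment> \<open>If \<open>a\<close> and \<open>b\<close> are perpendicular, then \<open>u = - \<sigma>\<close>, and the two offset equations give
      incompatible values for \<open>p'\<close>.\<close>
    have \<kappa>: "Re (cnj u * w) \<noteq> 0"
    proof
      assume 0: "Re (cnj u * w) = 0"
      have nz: "u \<noteq> 0" using u by auto
      have "w\<^sup>2 + u\<^sup>2 = 0"
        using two_Re_cnj_mult_units[OF u(1) w(1)] unfolding 0 by simp
      then have "u\<^sup>2 * (\<sigma> * u + 1) = 0" unfolding w2 by algebra
      then have "\<sigma> * u + 1 = 0" using nz by simp
      then have "u = - of_real \<sigma>" using \<sigma> by (auto simp: add_eq_0_iff minus_equation_iff)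
      then show False using \<sigma> p' q' 0 by auto
    qed
    have "p' = p u" using p' c by (simp add: p_def field_simps)
    moreover have "q' = q \<sigma> u w" using q' \<kappa> \<open>p' = p u\<close> by (simp add: q_def field_simps)
    moreover have "u \<in> U \<sigma>"
    proof -
      have "(u\<^sup>2 + \<sigma> * u + 1) * (u ^ 7 + \<sigma> * m\<^sup>2) = 0"
        using septic_equation[OF u(1) w(1) m \<sigma> c \<kappa> p' w2 q'] R by blast
      moreover have "u ^ 3 = \<sigma>" if "u\<^sup>2 + \<sigma> * u + 1 = 0"
      proof -
        have "u ^ 3 - \<sigma> = (u - \<sigma>) * (u\<^sup>2 + \<sigma> * u + 1)"
          using \<sigma> by (auto simp: algebra_simps power3_eq_cube power2_eq_square)
        then show ?thesis using that by simp
      qed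
      ultimately show ?thesis by (auto simp: U_def add_eq_0_iff)
    qed
    moreover have "w \<in> W \<sigma> u" using w2 by (simp add: W_def)
    ultimately show "(a, b) \<in> F"
      using \<sigma> u w unfolding F_def by (intro image_eqI[of _ _ "(\<sigma>, u, w)"]) auto
  qed
  ultimately show ?thesis by (rule finite_subset[rotated])
qed

text \<open>
  The solution on the branch \<open>\<sigma> = 1\<close>.  The bound on \<open>\<theta>\<close> keeps the denominators \<open>cos \<theta>\<close> and
  \<open>cos (\<theta> / 2)\<close> of the offsets positive; septisection needs it for \<open>\<theta> = \<phi> / 7 < 2 * pi / 7\<close>.
\<close>

lemma septisection_folds_exist:
  assumes "0 < \<theta>" "\<theta> < pi / 2"
  shows "\<exists>p w q. cmod w = 1 \<and>
    septisection_folds (normal_line (\<i> * cis (7 * \<theta> / 2)) (Re (\<i> * cis (7 * \<theta> / 2))))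
      (normal_line (cis \<theta>) p) (normal_line w q)"
proof -
  define m u w where "m = \<i> * cis (7 * \<theta> / 2)" and "u = cis \<theta>" and "w = cis (3 * \<theta> / 2)"
  define p where "p = (2 * (Re u)\<^sup>2 - 1) / (2 * Re u)"
  define q where "q = (p + 2 * p * Re u) / (2 * Re (cnj u * w))"
  have unit: "cmod u = 1" "cmod w = 1" "cmod m = 1" by (simp_all add: u_def w_def m_def norm_mult)
  have c: "Re u \<noteq> 0" using cos_gt_zero_pi[of \<theta>] assms by (simp add: u_def)
  have "cnj u * w = cis (\<theta> / 2)" by (simp add: u_def w_def cis_cnj cis_mult)
  then have \<kappa>: "Re (cnj u * w) \<noteq> 0" using cos_gt_zero_pi[of "\<theta> / 2"] assms by simp
  have p: "2 * p * Re u = 2 * (Re u)\<^sup>2 - 1" using c by (simp add: p_def)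
  have w2: "w\<^sup>2 = of_real 1 * u ^ 3" 
    unfolding u_def w_def Complex.DeMoivre of_real_1 mult_1 by (rule arg_cong[of _ _ cis]) simp
  have q: "2 * q * Re (cnj u * w) - p = 1 * (2 * p * Re u)" 
  proof -
    have "2 * ((p + x) / (2 * y)) * y - p = 1 * x" if "y \<noteq> 0" for x y
      using that by (simp add: field_simps)
    from this[OF \<kappa>] show ?thesis unfolding q_def .
  qed
  have "u ^ 7 + of_real 1 * m\<^sup>2 = 0"
  proof -
    have "(cis (7 * \<theta> / 2))\<^sup>2 = u ^ 7"
      unfolding u_def Complex.DeMoivre by (rule arg_cong[of _ _ cis]) simp
    then show ?thesis by (simp add: m_def power_mult_distrib)
  qed
  then have "Re (cnj m * (2 * of_real q * w + w\<^sup>2)) = Re m"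
    using septic_equation[OF unit _ c \<kappa> p w2 q] by simp
  then have "septisection_folds (normal_line m (Re m)) (normal_line u p) (normal_line w q)"
    unfolding septisection_folds_iff[OF unit(1,2)] using p w2 q by blast
  then show ?thesis using unit(2) unfolding m_def u_def by blast
qed

lemma constructible_line_septisection_fold:
  assumes n: "constructible_line E (normal_line m (Re m))" and m: "cmod m = 1"
    and folds: "septisection_folds (normal_line m (Re m)) a b" "is_line a" "is_line b"
  shows "constructible_line E a"
proof -
  have "constructible_point E (pt (-1))"
    using constructible_point_reflect[OF constructible_line_y_axis constructible_point_start(2)] by simp
  then obtain Ps Ls where S: "origami_stage E Ps Ls" "{pt 1, pt (-1)} \<subseteq> Ps"
      "{normal_line 1 0, normal_line m (Re m)} \<subseteq> Ls"
    using common_stage[of "{pt 1, pt (-1)}" E "{normal_line 1 0, normal_line m (Re m)}"]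
      constructible_point_start(2) constructible_line_y_axis n by blast
  \<comment> \<open>Both sides are written as functions of the pair of folds to match the form of alignments.\<close>
  define A :: "(line \<times> line \<Rightarrow> bool) set" where
    "A = {(\<lambda>f. (\<lambda>(a, b). reflect b ` a) f = (\<lambda>(a, b). reflect a ` normal_line 1 0) f),
          (\<lambda>f. (\<lambda>(a, b). reflect a (pt 1)) f \<in> (\<lambda>(a, b). normal_line 1 0) f),
          (\<lambda>f. (\<lambda>(a, b). reflect b (pt (-1))) f \<in> (\<lambda>(a, b). normal_line m (Re m)) f)}"
  have "A \<subseteq> alignments (two_fold_points Ps) (two_fold_lines Ls)"
    unfolding A_def using S(2,3)
    by (intro insert_subsetI empty_subsetI alignmentsI fold_objectsI) simp_all
  moreover have sols: "two_fold_solutions A =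
      {(a, b). is_line a \<and> is_line b \<and> septisection_folds (normal_line m (Re m)) a b}"
    by (auto simp: two_fold_solutions_def A_def septisection_folds_def)
  then have "finite (two_fold_solutions A)" using finite_septisection_folds[OF m] by simp
  moreover have "(a, b) \<in> two_fold_solutions A" using folds sols by simp
  moreover have "finite A" by (simp add: A_def)
  ultimately have "origami_stage E Ps (insert a (insert b Ls))"
    using origami_stage.two_fold[OF S(1)] by blast
  then show ?thesis unfolding constructible_line_def by blast
qed

section \<open>Septisection\<close>

lemma constructible_point_septisection:
  assumes "0 < \<phi>" "\<phi> < 2 * pi" and Z: "constructible_point E (pt (cis \<phi>))"
  shows "constructible_point E (pt (cis (\<phi> / 7)))"
proof -
  define u where "u = cis (\<phi> / 7)"
  \<comment> \<open>The chord from \<open>1\<close> to \<open>cis \<phi>\<close> has normal \<open>cis (\<phi> / 2)\<close>; the perpendicular to it at \<open>1\<close> is the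
    line with \<open>m\<^sup>2 = - cis \<phi>\<close> that the double fold requires.\<close>
  have "constructible_line E (normal_line (cis (\<phi> / 2)) (cos (\<phi> / 2)))"
  proof (rule constructible_line_join[OF constructible_point_start(2) Z])
    show "1 \<noteq> cis \<phi>"
    proof
      assume "1 = cis \<phi>"
      then have "cos \<phi> = 1" by (simp add: complex_eq_iff)
      then have "(sin (\<phi> / 2))\<^sup>2 = 0" using cos_double_sin[of "\<phi> / 2"] by simp
      then show False using sin_gt_zero[of "\<phi> / 2"] assms(1,2) by simp
    qed
    have "cnj (cis (\<phi> / 2)) * cis \<phi> = cis (\<phi> / 2)" by (simp add: cis_cnj cis_mult)
    then show "Re (cnj (cis (\<phi> / 2)) * cis \<phi>) = cos (\<phi> / 2)" by simp
  qed simp_all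
  from constructible_line_perpendicular[OF this constructible_point_start(2)]
  have n: "constructible_line E (normal_line (\<i> * cis (\<phi> / 2)) (Re (\<i> * cis (\<phi> / 2))))"
    by simp
  obtain p w q where "cmod w = 1" and
    "septisection_folds (normal_line (\<i> * cis (\<phi> / 2)) (Re (\<i> * cis (\<phi> / 2)))) (normal_line u p) (normal_line w q)"
    using septisection_folds_exist[of "\<phi> / 7"] assms(1,2) by (auto simp: u_def)
  moreover have u: "cmod u = 1" by (simp add: u_def)
  ultimately have "constructible_line E (normal_line u p)"
    using constructible_line_septisection_fold[OF n] is_line_iff_normal_line by (metis norm_cis norm_ii norm_mult mult_1)
  from constructible_line_perpendicular[OF this constructible_point_start(1) u]
  \<comment> \<open>The line through the origin with direction \<open>u\<close>.\<close>
  have g: "constructible_line E (normal_line (\<i> * u) 0)" by simp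
  have reflect_g: "constructible_point E (pt (u\<^sup>2 * cnj z))" if "constructible_point E (pt z)" for z
    using constructible_point_reflect[OF g that] u by (simp add: norm_mult power_mult_distrib)
  have reflect_x: "constructible_point E (pt (cnj z))" if "constructible_point E (pt z)" for z
    using constructible_point_reflect[OF constructible_line_x_axis that] by simp
  have step: "constructible_point E (pt (cis (\<theta> - 2 * \<phi> / 7)))" if "constructible_point E (pt (cis \<theta>))" for \<theta>
    using reflect_x[OF reflect_g[OF that]]
    by (simp add: u_def Complex.DeMoivre cis_cnj cis_mult)
  from step[OF step[OF step[OF Z]]] show ?thesis by simp
qed

theorem theorem6:
  fixes \<phi> :: real
  assumes "0 < \<phi>" and "\<phi> < 2 * pi"
  shows "two_fold_constructible {cos \<phi>, sin \<phi>} (cos (\<phi> / 7)) \<and>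
         two_fold_constructible {cos \<phi>, sin \<phi>} (sin (\<phi> / 7))"
proof -
  let ?E = "{cos \<phi>, sin \<phi>}"
  have "constructible_point ?E (pt (of_real (cos \<phi>)))" "constructible_point ?E (pt (of_real (sin \<phi>)))"
    by (simp_all add: constructible_point_start)
  then have "constructible_point ?E (pt (Complex (cos \<phi>) (sin \<phi>)))"
    using constructible_point_combine[OF _ constructible_point_swap] by fastforce
  then have "constructible_point ?E (pt (cis \<phi>))" by (simp add: cis.code)
  from two_fold_constructible_coordinates[OF constructible_point_septisection[OF assms this]]
  show ?thesis by simp
qed

end
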